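(* Let $A\in\mathbb{R}_+^{n\times n}$ be definite and let $X=\operatorname{diag}(x)$. (1) If $x=\bigoplus_{i=1}^n A^*_{\cdot i}$ (componentwise maximum of the columns of $A^*$), then $X^{-1}AX$ is visualized. (2) If $x=\sum_{i=1}^n A^*_{\cdot i}$ (conventional sum of the columns of $A^*$), then $X^{-1}AX$ is strictly visualized.
   Context: Max algebra: on $\mathbb{R}_+=[0,\infty)$ put $a\oplus b=\max(a,b)$, $a\otimes b=ab$, extended to matrices by $(A\oplus B)_{ij}=\max(a_{ij},b_{ij})$, $(A\otimes B)_{ij}=\max_k a_{ik}b_{kj}$; $A^k$ is the $k$-th max-algebraic power, $A^0=I$. The digraph $\mathcal{D}(A)$ has nodes $1,\dots,n$ and an edge $(i,j)$ of weight $a_{ij}$ iff $a_{ij}\neq 0$; the weight of a path is the product of its edge weights, and the geometric mean of a cycle with $k$ edges is its weight to the power $1/k$. $\lambda(A)$ is the maximum cycle geometric mean ($0$ if there are no cycles). $A$ is definite if $\lambda(A)=1$. A cycle is critical if its geometric mean equals $\lambda(A)$; $E_c(A)$ is the set of edges belonging to critical cycles. For definite $A$, $A^*=I\oplus A\oplus\dots\oplus A^{n-1}$ is the Kleene star, with columns $A^*_{\cdot i}$. $\operatorname{diag}(x)$ is the diagonal matrix with diagonal entries $x_1,\dots,x_n$, so that $(X^{-1}AX)_{ij}=x_i^{-1}a_{ij}x_j$. A definite matrix $A$ is visualized if $a_{ij}\le 1$ for all $i,j$ and $a_{ij}=1$ for all $(i,j)\in E_c(A)$. It is strictly visualized if it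 is visualized and, moreover, $a_{ij}=1$ if and only if $(i,j)\in E_c(A)$. *)

theory Defs
  imports "HOL-Analysis.Analysis"
begin

text \<open>Square matrices over the nonnegative reals are represented as real matrices together with
  the predicate \<open>nonneg_matrix\<close>; the node set of the associated digraph is the index type.\<close>

definition nonneg_matrix :: "real^'n^'m \<Rightarrow> bool" where
  "nonneg_matrix A \<longleftrightarrow> (\<forall>i j. 0 \<le> A $ i $ j)"

definition max_mult :: "real^'n^'n \<Rightarrow> real^'n^'n \<Rightarrow> real^'n^'n" (infixl \<open>\<otimes>\<^sub>m\<close> 70) where
  "A \<otimes>\<^sub>m B = (\<chi> i j. MAX k. A $ i $ k * B $ k $ j)"

primrec max_power :: "real^'n^'n \<Rightarrow> nat \<Rightarrow> real^'n^'n" where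
  "max_power A 0 = mat 1"
| "max_power A (Suc k) = A \<otimes>\<^sub>m max_power A k"

definition kleene_star :: "real^'n^'n \<Rightarrow> real^'n^'n" where
  "kleene_star A = (\<chi> i j. MAX k\<in>{..<CARD('n)}. max_power A k $ i $ j)"

definition digraph_edges :: "real^'n^'n \<Rightarrow> ('n \<times> 'n) set" where
  "digraph_edges A = {(i, j). A $ i $ j \<noteq> 0}"

text \<open>A path with \<open>k\<close> edges is the list of its \<open>k + 1\<close> nodes. Nodes may repeat, and a cycle is any
  closed path with at least one edge; its first node is listed again at the end.\<close>

definition path_edges :: "'n list \<Rightarrow> ('n \<times> 'n) list" where
  "path_edges p = zip p (tl p)"

definition digraph_path :: "real^'n^'n \<Rightarrow> 'n list \<Rightarrow> bool" where
  "digraph_path A p \<longleftrightarrow> p \<noteq> [] \<and> set (path_edges p) \<subseteq> digraph_edges A"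

definition path_weight :: "real^'n^'n \<Rightarrow> 'n list \<Rightarrow> real" where
  "path_weight A p = (\<Prod>(i, j)\<leftarrow>path_edges p. A $ i $ j)"

definition digraph_cycle :: "real^'n^'n \<Rightarrow> 'n list \<Rightarrow> bool" where
  "digraph_cycle A p \<longleftrightarrow> digraph_path A p \<and> path_edges p \<noteq> [] \<and> hd p = last p"

definition geometric_mean :: "real^'n^'n \<Rightarrow> 'n list \<Rightarrow> real" where
  "geometric_mean A p = path_weight A p powr (1 / real (length (path_edges p)))"

text \<open>There are infinitely many closed paths as soon as there is one, so the maximum is written as a
  supremum; \<open>max_cycle_mean_attained\<close> below shows that it is a maximum.\<close>

definition max_cycle_mean :: "real^'n^'n \<Rightarrow> real" where
  "max_cycle_mean A =
     (if \<exists>p. digraph_cycle A p then SUP p\<in>{p. digraph_cycle A p}. geometric_mean A p else 0)"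

definition definite :: "real^'n^'n \<Rightarrow> bool" where
  "definite A \<longleftrightarrow> max_cycle_mean A = 1"

definition critical_cycle :: "real^'n^'n \<Rightarrow> 'n list \<Rightarrow> bool" where
  "critical_cycle A p \<longleftrightarrow> digraph_cycle A p \<and> geometric_mean A p = max_cycle_mean A"

definition critical_edges :: "real^'n^'n \<Rightarrow> ('n \<times> 'n) set" where
  "critical_edges A = (\<Union>p\<in>{p. critical_cycle A p}. set (path_edges p))"

definition visualized :: "real^'n^'n \<Rightarrow> bool" where
  "visualized A \<longleftrightarrow> nonneg_matrix A \<and> definite A \<and>
     (\<forall>i j. A $ i $ j \<le> 1) \<and> (\<forall>(i, j)\<in>critical_edges A. A $ i $ j = 1)"

definition strictly_visualized :: "real^'n^'n \<Rightarrow> bool" where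
  "strictly_visualized A \<longleftrightarrow> visualized A \<and>
     (\<forall>i j. A $ i $ j = 1 \<longleftrightarrow> (i, j) \<in> critical_edges A)"

definition diag :: "real^'n \<Rightarrow> real^'n^'n" where
  "diag x = (\<chi> i j. if i = j then x $ i else 0)"

lemma diag_scaling_nth:
  assumes "\<And>i. x $ i \<noteq> 0"
  shows "(matrix_inv (diag x) ** A ** diag x) $ i $ j = inverse (x $ i) * A $ i $ j * x $ j"
proof -
  let ?Y = "diag (\<chi> i. inverse (x $ i))"
  have mult: "(diag y ** B) $ i $ j = y $ i * B $ i $ j" "(B ** diag y) $ i $ j = B $ i $ j * y $ j"
    for y :: "real^'n" and B i j
    by (simp_all add: diag_def matrix_matrix_mult_def if_distrib if_distribR cong: if_cong)
  have l: "?Y ** diag x = mat 1"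
    using assms by (simp add: vec_eq_iff mult) (simp add: diag_def mat_def)
  have r: "diag x ** ?Y = mat 1"
    using assms by (simp add: vec_eq_iff mult) (simp add: diag_def mat_def)
  have "matrix_inv (diag x) = ?Y"
  proof -
    have "\<exists>Z. diag x ** Z = mat 1 \<and> Z ** diag x = mat 1"
      using l r by blast
    then have "diag x ** matrix_inv (diag x) = mat 1"
      unfolding matrix_inv_def by (rule someI2_ex) blast
    then show ?thesis
      by (metis l matrix_mul_assoc matrix_mul_lid matrix_mul_rid)
  qed
  then show ?thesis by (simp add: mult)
qed

lemma path_edges_append:
  "path_edges (xs @ y # zs) = path_edges (xs @ [y]) @ path_edges (y # zs)"
proof (induction xs)
  case Nil
  then show ?case by (simp add: path_edges_def)
next
  case (Cons a xs)
  then show ?case by (cases xs) (auto simp: path_edges_def)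
qed

lemma path_weight_pos:
  assumes "nonneg_matrix A" "digraph_path A p"
  shows "0 < path_weight A p"
proof -
  have "0 < (\<Prod>(i, j)\<leftarrow>es. A $ i $ j)" if "set es \<subseteq> digraph_edges A" for es
    using that
  proof (induction es)
    case (Cons e es)
    obtain i j where e: "e = (i, j)" by force
    have "A $ i $ j \<noteq> 0" "0 \<le> A $ i $ j"
      using Cons.prems assms(1) e by (auto simp: digraph_edges_def nonneg_matrix_def)
    then show ?case using Cons e by simp
  qed simp
  then show ?thesis
    using assms(2) by (simp add: digraph_path_def path_weight_def)
qed

lemma path_weight_eq_mean_power:
  assumes "nonneg_matrix A" "digraph_cycle A p"
  shows "path_weight A p = geometric_mean A p ^ length (path_edges p)"
proof -
  have "0 < path_weight A p" "0 < length (path_edges p)"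
    using assms path_weight_pos by (auto simp: digraph_cycle_def)
  then show ?thesis
    by (simp add: geometric_mean_def powr_realpow[symmetric] powr_powr)
qed

lemma cycle_mean_le_short_cycle_mean:
  fixes A :: "real^'n^'n"
  assumes A: "nonneg_matrix A" and "digraph_cycle A p"
  shows "\<exists>q. digraph_cycle A q \<and> length q \<le> Suc CARD('n) \<and> geometric_mean A p \<le> geometric_mean A q"
  using assms(2)
proof (induction p rule: length_induct)
  case (1 p)
  note cyc = 1(2)
  show ?case
  proof (cases "length p \<le> Suc CARD('n)")
    case False
    let ?b = "butlast p"
    have ne: "p \<noteq> []" using cyc by (auto simp: digraph_cycle_def path_edges_def)
    have "\<not> distinct ?b"
    proof
      assume "distinct ?b"
      then have "length ?b \<le> CARD('n)" by (metis distinct_card card_mono finite subset_UNIV)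
      then show False using False by simp
    qed
    then obtain xs ys zs y where b: "?b = xs @ [y] @ ys @ [y] @ zs"
      using not_distinct_decomp by blast
    define l where "l = last p"
    have p: "p = xs @ y # ys @ y # zs @ [l]"
      using b ne append_butlast_last_id[of p] by (simp add: l_def)
    let ?p1 = "y # ys @ [y]" and ?p2 = "xs @ y # zs @ [l]"
    have e: "path_edges p = path_edges (xs @ [y]) @ path_edges ?p1 @ path_edges (y # zs @ [l])"
    proof -
      have "path_edges p = path_edges (xs @ [y]) @ path_edges ((y # ys) @ y # zs @ [l])"
        unfolding p using path_edges_append[of xs y "ys @ y # zs @ [l]"] by simp
      also have "path_edges ((y # ys) @ y # zs @ [l]) = path_edges ((y # ys) @ [y]) @ path_edges (y # zs @ [l])"
        by (rule path_edges_append)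
      finally show ?thesis by simp
    qed
    have e2: "path_edges ?p2 = path_edges (xs @ [y]) @ path_edges (y # zs @ [l])"
      by (rule path_edges_append)
    have c1: "digraph_cycle A ?p1"
      using cyc unfolding digraph_cycle_def digraph_path_def e by (simp add: path_edges_def)
    have "hd ?p2 = last ?p2"
      using cyc p by (cases xs) (auto simp: digraph_cycle_def)
    then have c2: "digraph_cycle A ?p2"
      using cyc unfolding digraph_cycle_def digraph_path_def e e2 by (simp add: path_edges_def)
    have le: "geometric_mean A p \<le> max (geometric_mean A ?p1) (geometric_mean A ?p2)"
    proof -
      let ?m = "max (geometric_mean A ?p1) (geometric_mean A ?p2)"
      have "geometric_mean A p ^ length (path_edges p) = path_weight A p"
        using path_weight_eq_mean_power[OF A cyc] by simp
      also have "\<dots> = path_weight A ?p1 * path_weight A ?p2"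
        unfolding path_weight_def e e2 by simp
      also have "\<dots> = geometric_mean A ?p1 ^ length (path_edges ?p1)
                       * geometric_mean A ?p2 ^ length (path_edges ?p2)"
        using path_weight_eq_mean_power[OF A] c1 c2 by simp
      also have "\<dots> \<le> ?m ^ length (path_edges ?p1) * ?m ^ length (path_edges ?p2)"
        by (intro mult_mono power_mono) (auto simp: geometric_mean_def le_max_iff_disj)
      also have "\<dots> = ?m ^ length (path_edges p)"
        unfolding e e2 by (simp add: power_add)
      finally show ?thesis
        using cyc by (subst (asm) power_mono_iff)
          (auto simp: geometric_mean_def digraph_cycle_def le_max_iff_disj)
    qed
    have "length ?p1 < length p" "length ?p2 < length p" by (simp_all add: p)
    with 1(1) c1 c2 obtain q1 q2 where
      "digraph_cycle A q1" "length q1 \<le> Suc CARD('n)" "geometric_mean A ?p1 \<le> geometric_mean A q1"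
      "digraph_cycle A q2" "length q2 \<le> Suc CARD('n)" "geometric_mean A ?p2 \<le> geometric_mean A q2"
      by blast
    then show ?thesis using le by (metis le_max_iff_disj order_trans)
  qed (use cyc in blast)
qed

lemma max_cycle_mean_attained:
  assumes A: "nonneg_matrix A" and "digraph_cycle A p"
  shows "\<exists>q. critical_cycle A q" and "geometric_mean A p \<le> max_cycle_mean A"
proof -
  let ?C = "{q. digraph_cycle A q \<and> length q \<le> Suc CARD('a)}"
  have fin: "finite ?C"
    by (rule finite_subset[OF _ finite_lists_length_le[of UNIV "Suc CARD('a)"]]) auto
  have ne: "?C \<noteq> {}"
    using cycle_mean_le_short_cycle_mean[OF assms] by blast
  have "\<exists>q\<in>?C. \<forall>r\<in>?C. geometric_mean A r \<le> geometric_mean A q"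
  proof -
    have "Max (geometric_mean A ` ?C) \<in> geometric_mean A ` ?C"
      using fin ne by (intro Max_in) auto
    then obtain q where "q \<in> ?C" "Max (geometric_mean A ` ?C) = geometric_mean A q"
      by (rule imageE)
    moreover have "\<forall>r\<in>?C. geometric_mean A r \<le> Max (geometric_mean A ` ?C)"
      using fin by simp
    ultimately show ?thesis by metis
  qed
  then obtain q where q: "q \<in> ?C" "\<forall>r\<in>?C. geometric_mean A r \<le> geometric_mean A q"
    by blast
  have max: "geometric_mean A r \<le> geometric_mean A q" if "digraph_cycle A r" for r
    using cycle_mean_le_short_cycle_mean[OF A that] q(2) by force
  then have "(SUP r\<in>{r. digraph_cycle A r}. geometric_mean A r) = geometric_mean A q"
    using q(1) by (intro cSup_eq_maximum) auto
  then have "max_cycle_mean A = geometric_mean A q"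
    using assms(2) by (auto simp: max_cycle_mean_def)
  then show "\<exists>q. critical_cycle A q" and "geometric_mean A p \<le> max_cycle_mean A"
    using q(1) max assms(2) by (auto simp: critical_cycle_def)
qed

end

(* Both choices of x are strictly positive max-algebraic subeigenvectors: a_ij x_j <= x_i, because
   every column of the Kleene star has this property (a path can be shortened by deleting
   cycles, whose weight is at most 1). Hence the scaled matrix has entries at most 1.
   The scaling does not change cycle weights, so the edges of a critical cycle are numbers in [0, 1] with product 1.
   For the sum of the columns, a scaled entry equal to 1 forces the inequality to be tight in every
   column; in column i this gives a_ij A*_ji = A*_ii >= 1, so a path realizing A*_ji closes the edge
   (i, j) to a critical cycle. *)

theory Submission
  imports Defs
begin

section \<open>Recursion and concatenation rules for paths\<close>

lemma path_edges_simps [simp]: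
  "path_edges [i] = []" "path_edges (i # j # p) = (i, j) # path_edges (j # p)"
  by (simp_all add: path_edges_def)

lemma path_weight_simps [simp]:
  "path_weight A [i] = 1" "path_weight A (i # j # p) = A $ i $ j * path_weight A (j # p)"
  by (simp_all add: path_weight_def)

lemma digraph_path_simps [simp]:
  "digraph_path A [i]"
  "digraph_path A (i # j # p) \<longleftrightarrow> A $ i $ j \<noteq> 0 \<and> digraph_path A (j # p)"
  by (simp_all add: digraph_path_def digraph_edges_def)

lemma digraph_path_append:
  "digraph_path A (xs @ y # zs) \<longleftrightarrow> digraph_path A (xs @ [y]) \<and> digraph_path A (y # zs)"
  by (auto simp: digraph_path_def path_edges_append[of xs y zs])

lemma path_weight_append:
  "path_weight A (xs @ y # zs) = path_weight A (xs @ [y]) * path_weight A (y # zs)"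
  by (simp add: path_weight_def path_edges_append[of xs y zs])

section \<open>Max-algebraic powers and the Kleene star as optimal path weights\<close>

lemma max_mult_ge: "A $ i $ k * B $ k $ j \<le> (A \<otimes>\<^sub>m B) $ i $ j"
  by (simp add: max_mult_def)

lemma max_mult_attained: "\<exists>k. (A \<otimes>\<^sub>m B) $ i $ j = A $ i $ k * B $ k $ j"
proof -
  have "Max (range (\<lambda>k. A $ i $ k * B $ k $ j)) \<in> range (\<lambda>k. A $ i $ k * B $ k $ j)"
    by (rule Max_in) auto
  then show ?thesis unfolding max_mult_def by (simp add: image_iff)
qed

text \<open>The maximum in each product is attained at some intermediate node; these nodes, taken in
  order, form the path. A zero entry need not have a path behind it.\<close>

lemma max_power_attained:
  assumes "max_power A k $ i $ j \<noteq> 0"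
  shows "\<exists>p. digraph_path A (i # p) \<and> last (i # p) = j \<and> length p = k \<and>
    path_weight A (i # p) = max_power A k $ i $ j"
  using assms
proof (induction k arbitrary: i)
  case 0
  then show ?case by (auto simp: mat_def split: if_splits)
next
  case (Suc k)
  obtain l where l: "max_power A (Suc k) $ i $ j = A $ i $ l * max_power A k $ l $ j"
    using max_mult_attained by fastforce
  with Suc.prems have "A $ i $ l \<noteq> 0" "max_power A k $ l $ j \<noteq> 0" by auto
  with Suc.IH obtain p where "digraph_path A (l # p)" "last (l # p) = j" "length p = k"
    "path_weight A (l # p) = max_power A k $ l $ j" by blast
  with l \<open>A $ i $ l \<noteq> 0\<close> show ?case by (intro exI[of _ "l # p"]) simp
qed

text \<open>The maximum in each product dominates the term of the path's own next node;
  nonnegativity allows multiplying the induction hypothesis by an edge weight.\<close>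

lemma path_weight_le_max_power:
  assumes "nonneg_matrix A"
  shows "path_weight A (i # p) \<le> max_power A (length p) $ i $ last (i # p)"
proof (induction p arbitrary: i)
  case Nil
  then show ?case by (simp add: mat_def)
next
  case (Cons j p)
  have "path_weight A (i # j # p) \<le> A $ i $ j * max_power A (length p) $ j $ last (j # p)"
    using Cons.IH[of j] assms by (simp add: nonneg_matrix_def mult_left_mono)
  also have "\<dots> \<le> max_power A (length (j # p)) $ i $ last (i # j # p)"
    using max_mult_ge[of A i j "max_power A (length p)"] by simp
  finally show ?case .
qed

lemma kleene_star_ge:
  fixes A :: "real^'n^'n"
  assumes "k < CARD('n)"
  shows "max_power A k $ i $ j \<le> kleene_star A $ i $ j"
  using assms by (simp add: kleene_star_def)

text \<open>The power 0 contributes the identity matrix. This bound makes both choices of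
  \<open>x\<close> positive and later forces a cycle weight up to 1.\<close>

lemma kleene_star_diag_ge_1:
  fixes A :: "real^'n^'n"
  shows "1 \<le> kleene_star A $ i $ i"
  using kleene_star_ge[of 0 A i i] by (simp add: mat_def)

lemma kleene_star_nonneg:
  fixes A :: "real^'n^'n"
  shows "0 \<le> kleene_star A $ i $ j"
  using kleene_star_ge[of 0 A i j] by (simp add: mat_def split: if_splits)

lemma kleene_star_attained:
  fixes A :: "real^'n^'n"
  assumes "kleene_star A $ i $ j \<noteq> 0"
  shows "\<exists>p. digraph_path A (i # p) \<and> last (i # p) = j \<and> path_weight A (i # p) = kleene_star A $ i $ j"
proof -
  have "Max ((\<lambda>k. max_power A k $ i $ j) ` {..<CARD('n)}) \<in> (\<lambda>k. max_power A k $ i $ j) ` {..<CARD('n)}"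
    by (rule Max_in) (auto simp: lessThan_empty_iff)
  then obtain k where "kleene_star A $ i $ j = max_power A k $ i $ j"
    by (auto simp: kleene_star_def)
  with assms max_power_attained[of A k i j] show ?thesis by metis
qed

section \<open>Cycle weights and path shortening in a definite matrix\<close>

lemma definite_cycle_weight_le_1:
  assumes "nonneg_matrix A" "definite A" "digraph_cycle A p"
  shows "path_weight A p \<le> 1"
proof -
  have "geometric_mean A p \<le> 1"
    using max_cycle_mean_attained(2)[OF assms(1,3)] assms(2) by (simp add: definite_def)
  moreover have "0 \<le> geometric_mean A p" by (simp add: geometric_mean_def)
  ultimately show ?thesis
    unfolding path_weight_eq_mean_power[OF assms(1,3)] by (intro power_le_one)
qed

text \<open>The value 1 is unchanged by taking roots and powers, so the length of the cycle drops
  out of the criterion.\<close>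

lemma critical_cycle_iff_weight:
  assumes "nonneg_matrix A" "definite A"
  shows "critical_cycle A p \<longleftrightarrow> digraph_cycle A p \<and> path_weight A p = 1"
proof -
  have "geometric_mean A p = 1 \<longleftrightarrow> path_weight A p = 1" if "digraph_cycle A p"
  proof
    assume "geometric_mean A p = 1"
    then show "path_weight A p = 1" using path_weight_eq_mean_power[OF assms(1) that] by simp
  qed (simp add: geometric_mean_def)
  then show ?thesis using assms(2) by (auto simp: critical_cycle_def definite_def)
qed

text \<open>A repeated node encloses a cycle of weight at most 1, and deleting it does not lower the
  weight. The bound counts nodes, so at most \<open>CARD('n) - 1\<close> edges remain, the highest
  power in \<open>kleene_star\<close>.\<close>

lemma definite_shorten_path:
  fixes A :: "real^'n^'n"
  assumes A: "nonneg_matrix A" "definite A" and "digraph_path A p"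
  shows "\<exists>q. digraph_path A q \<and> length q \<le> CARD('n) \<and> hd q = hd p \<and> last q = last p \<and>
    path_weight A p \<le> path_weight A q"
  using assms(3)
proof (induction p rule: length_induct)
  case (1 p)
  show ?case
  proof (cases "distinct p")
    case True
    then have "length p \<le> CARD('n)" by (metis distinct_card card_mono finite subset_UNIV)
    with 1(2) show ?thesis by blast
  next
    case False
    then obtain xs ys zs y where p: "p = xs @ y # (ys @ y # zs)"
      using not_distinct_decomp[of p] by auto
    \<comment> \<open>\<open>?c\<close> is the cycle between two occurrences of \<open>y\<close>,
      and \<open>?q\<close> is the path with it cut out.\<close>
    let ?c = "y # ys @ [y]" and ?q = "xs @ y # zs"
    have paths: "digraph_path A (xs @ [y])" "digraph_path A ?c" "digraph_path A (y # zs)"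
      using 1(2) digraph_path_append[of A "y # ys" y zs] digraph_path_append[of A xs y "ys @ y # zs"]
      by (auto simp: p)
    have q: "digraph_path A ?q" using paths digraph_path_append by blast
    have "path_weight A ?c \<le> 1"
      using paths(2) by (intro definite_cycle_weight_le_1 A) (simp add: digraph_cycle_def path_edges_def)
    moreover have "path_weight A p = path_weight A ?c * path_weight A ?q"
      using path_weight_append[of A xs y "ys @ y # zs"] path_weight_append[of A xs y zs]
        path_weight_append[of A "y # ys" y zs]
      by (simp add: p)
    ultimately have le: "path_weight A p \<le> path_weight A ?q"
      using path_weight_pos[OF A(1) q] by simp
    have "length ?q < length p" by (simp add: p)
    with 1(1) q obtain r where "digraph_path A r" "length r \<le> CARD('n)" "hd r = hd ?q"
      "last r = last ?q" "path_weight A ?q \<le> path_weight A r" by blast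
    moreover have "hd ?q = hd p" "last ?q = last p" by (cases xs; simp add: p)+
    ultimately show ?thesis using le by (intro exI[of _ r]) auto
  qed
qed

text \<open>Prepending the edge \<open>(i, k)\<close> to a path that realizes the star entry may
  give too many edges for the powers in the star; shortening repairs this without losing
  weight.\<close>

lemma definite_kleene_star_subeigen:
  fixes A :: "real^'n^'n"
  assumes A: "nonneg_matrix A" "definite A"
  shows "A $ i $ k * kleene_star A $ k $ j \<le> kleene_star A $ i $ j"
proof (cases "A $ i $ k = 0 \<or> kleene_star A $ k $ j = 0")
  case True
  then show ?thesis using kleene_star_nonneg[of A i j] by auto
next
  case False
  then obtain p where p: "digraph_path A (k # p)" "last (k # p) = j"
    "path_weight A (k # p) = kleene_star A $ k $ j"
    using kleene_star_attained[of A k j] by blast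
  with False have "digraph_path A (i # k # p)" by simp
  from definite_shorten_path[OF A this] p obtain q where q: "digraph_path A q" "length q \<le> CARD('n)"
    "hd q = i" "last q = j" "A $ i $ k * kleene_star A $ k $ j \<le> path_weight A q"
    by auto
  then obtain q' where q': "q = i # q'" by (cases q) (auto simp: digraph_path_def)
  note q(5)
  also have "path_weight A q \<le> max_power A (length q') $ i $ j"
    using path_weight_le_max_power[OF A(1), of i q'] q(4) q' by simp
  \<comment> \<open>\<open>length q'\<close> is the number of edges of \<open>q\<close>, one less
    than its number of nodes, hence below \<open>CARD('n)\<close>.\<close>
  also have "\<dots> \<le> kleene_star A $ i $ j"
    using q(2) q' by (intro kleene_star_ge) simp
  finally show ?thesis .
qed

text \<open>The product of the other factors is at most 1, so \<open>f x\<close> is at least the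
  whole product.\<close>

lemma prod_list_eq_1_imp_eq_1:
  fixes f :: "'a \<Rightarrow> real"
  assumes "prod_list (map f xs) = 1" "\<And>x. x \<in> set xs \<Longrightarrow> 0 \<le> f x \<and> f x \<le> 1" "x \<in> set xs"
  shows "f x = 1"
proof -
  have le: "0 \<le> prod_list (map f ys) \<and> prod_list (map f ys) \<le> 1" if "set ys \<subseteq> set xs" for ys
    using that
  proof (induction ys)
    case (Cons y ys)
    then show ?case using assms(2)[of y] by (simp add: mult_le_one)
  qed simp
  obtain ys zs where xs: "xs = ys @ x # zs" using assms(3) split_list by metis
  then have "f x * (prod_list (map f ys) * prod_list (map f zs)) = 1"
    using assms(1) by (simp add: algebra_simps)
  moreover have "prod_list (map f ys) * prod_list (map f zs) \<le> 1"
    using le[of ys] le[of zs] xs by (auto intro: mult_le_one)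
  ultimately show ?thesis
    using assms(2)[OF assms(3)] mult_left_le[of "prod_list (map f ys) * prod_list (map f zs)" "f x"]
    by linarith
qed

section \<open>Diagonal scaling by a positive vector\<close>

context
  fixes A :: "real^'n^'n" and x :: "real^'n"
  assumes A: "nonneg_matrix A" and x: "\<And>i. 0 < x $ i"
begin

abbreviation (input) scaled :: "real^'n^'n" where
  "scaled \<equiv> matrix_inv (diag x) ** A ** diag x"

lemma scaled_nth: "scaled $ i $ j = A $ i $ j * x $ j / x $ i"
  by (subst diag_scaling_nth) (simp_all add: field_simps x[THEN less_imp_neq, THEN not_sym])

lemma scaled_nonneg: "nonneg_matrix scaled"
  using A x by (simp add: nonneg_matrix_def scaled_nth less_imp_le)

lemma digraph_edges_scaled: "digraph_edges scaled = digraph_edges A"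
  by (simp add: digraph_edges_def scaled_nth x[THEN less_imp_neq, THEN not_sym])

lemma digraph_cycle_scaled: "digraph_cycle scaled p \<longleftrightarrow> digraph_cycle A p"
  by (simp add: digraph_cycle_def digraph_path_def digraph_edges_scaled)

text \<open>The factors \<open>x $ j / x $ i\<close> telescope along the path; on a cycle the
  remaining quotient is 1.\<close>

lemma path_weight_scaled:
  assumes "p \<noteq> []"
  shows "path_weight scaled p = path_weight A p * x $ last p / x $ hd p"
  using assms
proof (induction p rule: induct_list012)
  case (2 i)
  then show ?case using x[of i] by simp
next
  case (3 i j p)
  then show ?case using x[of i] x[of j] by (simp add: scaled_nth)
qed simp

lemma geometric_mean_scaled:
  assumes "digraph_cycle A p"
  shows "geometric_mean scaled p = geometric_mean A p"
proof -
  have "p \<noteq> []" "last p = hd p" using assms by (auto simp: digraph_cycle_def digraph_path_def)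
  then show ?thesis using x[of "hd p"] by (simp add: geometric_mean_def path_weight_scaled)
qed

lemma max_cycle_mean_scaled: "max_cycle_mean scaled = max_cycle_mean A"
proof -
  have "geometric_mean scaled ` {p. digraph_cycle A p} = geometric_mean A ` {p. digraph_cycle A p}"
    by (rule image_cong) (simp_all add: geometric_mean_scaled)
  then show ?thesis unfolding max_cycle_mean_def digraph_cycle_scaled by simp
qed

lemma critical_edges_scaled: "critical_edges scaled = critical_edges A"
proof -
  have "critical_cycle scaled p \<longleftrightarrow> critical_cycle A p" for p
    by (auto simp: critical_cycle_def digraph_cycle_scaled max_cycle_mean_scaled geometric_mean_scaled)
  then show ?thesis by (simp add: critical_edges_def)
qed

text \<open>Common core of both claims. Dividing \<open>sub\<close> by \<open>x $ i\<close> bounds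
  the scaled entries by 1, and the weight 1 of a critical cycle then forces each of its edges to
  have weight 1.\<close>

lemma visualized_if_subeigenvector:
  assumes "definite A" and sub: "\<And>i j. A $ i $ j * x $ j \<le> x $ i"
  shows "visualized scaled"
proof -
  have def: "definite scaled" using assms(1) by (simp add: definite_def max_cycle_mean_scaled)
  have le: "scaled $ i $ j \<le> 1" for i j
    using sub[of i j] x[of i] by (simp add: scaled_nth)
  have "scaled $ i $ j = 1" if "(i, j) \<in> critical_edges scaled" for i j
  proof -
    from that obtain p where p: "critical_cycle scaled p" "(i, j) \<in> set (path_edges p)"
      by (auto simp: critical_edges_def)
    then have "(\<Prod>e\<leftarrow>path_edges p. case e of (i, j) \<Rightarrow> scaled $ i $ j) = 1"
      using critical_cycle_iff_weight[OF scaled_nonneg def] by (simp add: path_weight_def)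
    from prod_list_eq_1_imp_eq_1[OF this _ p(2)] show ?thesis
      using scaled_nonneg le by (auto simp: nonneg_matrix_def)
  qed
  with def le scaled_nonneg show ?thesis by (auto simp: visualized_def)
qed

end

section \<open>Tight inequalities and the two choices of \<open>x\<close>\<close>

lemma kleene_star_tight_imp_critical:
  assumes A: "nonneg_matrix A" "definite A"
    and eq: "A $ i $ j * kleene_star A $ j $ i = kleene_star A $ i $ i"
  shows "(i, j) \<in> critical_edges A"
proof -
  have ge: "1 \<le> A $ i $ j * kleene_star A $ j $ i"
    using eq kleene_star_diag_ge_1[of A i] by simp
  then have "A $ i $ j \<noteq> 0" "kleene_star A $ j $ i \<noteq> 0" by auto
  moreover from this obtain p where p: "digraph_path A (j # p)" "last (j # p) = i"
    "path_weight A (j # p) = kleene_star A $ j $ i"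
    using kleene_star_attained[of A j i] by blast
  ultimately have "digraph_cycle A (i # j # p)" by (simp add: digraph_cycle_def)
  \<comment> \<open>\<open>ge\<close> bounds the weight of this cycle from below by 1, definiteness
    from above.\<close>
  then have "critical_cycle A (i # j # p)"
    using definite_cycle_weight_le_1[OF A, of "i # j # p"] ge p(3)
    by (simp add: critical_cycle_iff_weight[OF A])
  then show ?thesis by (auto simp: critical_edges_def intro!: bexI[of _ "i # j # p"])
qed

theorem proposition3p1:
  fixes A X :: "real^'n^'n" and x :: "real^'n"
  assumes "nonneg_matrix A" and "definite A" and "X = diag x"
  shows "(x = (\<chi> k. MAX i. column i (kleene_star A) $ k) \<longrightarrow>
            visualized (matrix_inv X ** A ** X)) \<and>
         (x = (\<Sum>i\<in>UNIV. column i (kleene_star A)) \<longrightarrow>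
            strictly_visualized (matrix_inv X ** A ** X))"
proof (intro conjI impI)
  note A = assms(1,2)
  let ?S = "kleene_star A"
  note sub = definite_kleene_star_subeigen[OF A]
  {
    assume "x = (\<chi> k. MAX i. column i ?S $ k)"
    then have x: "x $ k = (MAX i. ?S $ k $ i)" for k by (simp add: column_def)
    have ge: "?S $ k $ i \<le> x $ k" for k i by (simp add: x)
    have pos: "0 < x $ k" for k using ge[of k k] kleene_star_diag_ge_1[of A k] by linarith
    have "A $ i $ j * x $ j \<le> x $ i" for i j
    proof -
      \<comment> \<open>The maximum \<open>x $ j\<close> is attained in a single column
        \<open>l\<close>, so the inequality for that column suffices.\<close>
      have "Max (range (\<lambda>l. ?S $ j $ l)) \<in> range (\<lambda>l. ?S $ j $ l)" by (rule Max_in) auto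
      then obtain l where "x $ j = ?S $ j $ l" by (metis x rangeE)
      then show ?thesis using sub[of i j l] ge[of i l] by simp
    qed
    then show "visualized (matrix_inv X ** A ** X)"
      unfolding assms(3) using A pos by (intro visualized_if_subeigenvector)
  next
    assume "x = (\<Sum>i\<in>UNIV. column i ?S)"
    then have x: "x $ k = (\<Sum>i\<in>UNIV. ?S $ k $ i)" for k by (simp add: column_def)
    have ge: "?S $ k $ i \<le> x $ k" for k i
      unfolding x by (intro member_le_sum) (simp_all add: kleene_star_nonneg)
    have pos: "0 < x $ k" for k using ge[of k k] kleene_star_diag_ge_1[of A k] by linarith
    have sum: "A $ i $ j * x $ j = (\<Sum>l\<in>UNIV. A $ i $ j * ?S $ j $ l)" for i j
      by (simp add: x sum_distrib_left)
    have "A $ i $ j * x $ j \<le> x $ i" for i j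
      unfolding sum by (simp add: x sum_mono sub)
    then have vis: "visualized (matrix_inv X ** A ** X)"
      unfolding assms(3) using A pos by (intro visualized_if_subeigenvector)
    have "(i, j) \<in> critical_edges A" if "(matrix_inv X ** A ** X) $ i $ j = 1" for i j
    proof -
      \<comment> \<open>A scaled entry 1 means \<open>A $ i $ j * x $ j = x $ i\<close>, written
        here as sums over the columns.\<close>
      have "(\<Sum>l\<in>UNIV. A $ i $ j * ?S $ j $ l) = (\<Sum>l\<in>UNIV. ?S $ i $ l)"
        using that pos[of i] sum[of i j] x[of i] unfolding assms(3) scaled_nth[OF A(1) pos]
        by (simp add: field_simps)
      \<comment> \<open>Termwise inequalities with equal sums are equalities in every column; column
        \<open>i\<close> is chosen because there \<open>(i, j)\<close> closes a path from
        \<open>j\<close> back to \<open>i\<close>.\<close>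
      then have "A $ i $ j * ?S $ j $ i = ?S $ i $ i"
        using sum_mono_inv[of "\<lambda>l. A $ i $ j * ?S $ j $ l" UNIV "\<lambda>l. ?S $ i $ l" i] sub by simp
      then show ?thesis by (rule kleene_star_tight_imp_critical[OF A])
    qed
    \<comment> \<open>Scaling preserves the critical edges, so the edges found for \<open>A\<close>
      serve; the converse implication is part of \<open>vis\<close>.\<close>
    with vis show "strictly_visualized (matrix_inv X ** A ** X)"
      using critical_edges_scaled[OF A(1) pos] assms(3)
      by (auto simp: strictly_visualized_def visualized_def)
  }
qed

end
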